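(* Let $N \ge 1$ be an integer and let $A \in \mathbb{C}^{2N \times 2N}$ be a conjugate symplectic matrix, i.e. $A^* J A = J$ where $J = \begin{bmatrix} O & I_N \\ -I_N & O \end{bmatrix}$. Write $A = \begin{bmatrix} A_{11} & A_{12} \\ A_{21} & A_{22} \end{bmatrix}$ with $A_{11}, A_{12}, A_{21}, A_{22} \in \mathbb{C}^{N \times N}$. Then $$\det(A) = \frac{\det\left((A_{11} + A_{22})^2 + (A_{12} - A_{21})^2 - i[A_{11} + A_{22},\, A_{12} - A_{21}]\right)}{\left|\det\left((A_{11} + A_{22})^2 + (A_{12} - A_{21})^2 - i[A_{11} + A_{22},\, A_{12} - A_{21}]\right)\right|}.$$
   Context: $I_N$ denotes the $N \times N$ identity matrix, $O$ the $N \times N$ zero matrix, and $A^*$ the conjugate transpose of $A$. For $C, D \in \mathbb{C}^{N\times N}$, $[C,D] := CD - DC$ is the commutator. $i$ is the imaginary unit. *)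

theory Defs
  imports Complex_Main "Jordan_Normal_Form.Schur_Decomposition"
begin

definition symplectic_J :: "nat \<Rightarrow> complex mat" where
  "symplectic_J N = four_block_mat (0\<^sub>m N N) (1\<^sub>m N) (- 1\<^sub>m N) (0\<^sub>m N N)"

(* mat_adjoint is the conjugate transpose: conjugate is cnj on complex. *)
definition conjugate_symplectic :: "nat \<Rightarrow> complex mat \<Rightarrow> bool" where
  "conjugate_symplectic N A \<longleftrightarrow>
     A \<in> carrier_mat (2 * N) (2 * N) \<and>
     mat_adjoint A * symplectic_J N * A = symplectic_J N"

definition mat_commutator :: "complex mat \<Rightarrow> complex mat \<Rightarrow> complex mat" where
  "mat_commutator C D = C * D - D * C"

end

theory Submission
  imports Defs
begin

text \<open>
  Put \<open>C = A11 + A22\<close>, \<open>D = A12 - A21\<close>, \<open>F = C + \<i>D\<close> and \<open>G = C - \<i>D\<close>; the matrix in the theorem is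
  \<open>F G\<close>. Since \<open>A\<close> has inverse \<open>B = -J A\<^sup>* J\<close>, it maps the block columns \<open>B (I, \<i>I)\<close>, \<open>(I, -\<i>I)\<close>
  to \<open>(I, \<i>I)\<close>, \<open>A (I, -\<i>I)\<close>. One block row operation makes each of these \<open>2N \<times> 2N\<close>
  matrices triangular, and comparing determinants gives \<open>det A * cnj (det F) = det G\<close>.
  With \<open>(P, Q) = A (I, -\<i>I)\<close> the relation \<open>A\<^sup>* J A = J\<close> also gives
  \<open>G\<^sup>* G = P\<^sup>* P + Q\<^sup>* Q + 2I\<close>, so \<open>det G\<close> and hence \<open>det F\<close> are nonzero. As \<open>A\<close> has determinant of
  modulus 1, \<open>det F * det G = det A * (cmod (det F))\<^sup>2\<close> has phase \<open>det A\<close>.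
\<close>

section \<open>Conjugate transposes and block matrices\<close>

declare minus_carrier_mat [simp] uminus_carrier_mat [simp]

lemma mat_adjoint_eq_map_transpose: "mat_adjoint A = map_mat conjugate (transpose_mat A)"
  unfolding mat_adjoint_def by (rule eq_matI) (auto simp: mat_of_rows_def)

lemma mat_adjoint_carrier [simp]:
  "A \<in> carrier_mat n m \<Longrightarrow> mat_adjoint A \<in> carrier_mat m n"
  by (auto simp: mat_adjoint_eq_map_transpose)

lemma index_mat_adjoint [simp]:
  "i < dim_col A \<Longrightarrow> j < dim_row A \<Longrightarrow> mat_adjoint A $$ (i, j) = conjugate (A $$ (j, i))"
  "dim_row (mat_adjoint A) = dim_col A" "dim_col (mat_adjoint A) = dim_row A"
  by (auto simp: mat_adjoint_eq_map_transpose)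

lemma det_mat_adjoint:
  fixes A :: "complex mat"
  assumes "A \<in> carrier_mat n n"
  shows "det (mat_adjoint A) = cnj (det A)"
proof -
  interpret comm_ring_hom cnj by unfold_locales auto
  have "mat_adjoint A = map_mat cnj (transpose_mat A)"
    by (rule eq_matI) auto
  then show ?thesis using assms by (simp add: det_transpose)
qed

lemma mat_adjoint_mult:
  fixes A B :: "complex mat"
  assumes "A \<in> carrier_mat n k" "B \<in> carrier_mat k m"
  shows "mat_adjoint (A * B) = mat_adjoint B * mat_adjoint A"
  using assms by (intro eq_matI) (auto simp: scalar_prod_def mult.commute)

lemma mat_adjoint_four_block_mat:
  assumes "A \<in> carrier_mat n1 m1" "B \<in> carrier_mat n1 m2"
    "C \<in> carrier_mat n2 m1" "D \<in> carrier_mat n2 m2"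
  shows "mat_adjoint (four_block_mat A B C D) =
    four_block_mat (mat_adjoint A) (mat_adjoint C) (mat_adjoint B) (mat_adjoint D)"
  using assms by (intro eq_matI) auto

text \<open>Used to read an \<open>N x N\<close> relation off an equation between
  \<open>2N x 2N\<close> matrices: entry \<open>(i, j)\<close> of the lower right block sits at
  \<open>(n1 + i, m1 + j)\<close>.\<close>

lemma four_block_mat_lower_right_eqD:
  assumes "four_block_mat A B C D = four_block_mat A' B' C' D'"
    "A \<in> carrier_mat n1 m1" "A' \<in> carrier_mat n1 m1"
    "D \<in> carrier_mat n2 m2" "D' \<in> carrier_mat n2 m2"
  shows "D = D'"
proof (rule eq_matI)
  fix i j assume "i < dim_row D'" "j < dim_col D'"
  then show "D $$ (i, j) = D' $$ (i, j)"
    using arg_cong[OF assms(1), of "\<lambda>M. M $$ (n1 + i, m1 + j)"] assms(2-) by auto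
qed (use assms in auto)

section \<open>Gram matrices and positivity\<close>

lemma cscalar_prod_mat_adjoint_mult:
  fixes R :: "complex mat"
  assumes "R \<in> carrier_mat n m" "v \<in> carrier_vec m"
  shows "(mat_adjoint R * R *\<^sub>v v) \<bullet>c v = (R *\<^sub>v v) \<bullet>c (R *\<^sub>v v)"
proof -
  \<comment> \<open>The adjoint moves across the Hermitian product by exchanging a double sum; the
    claim is the case \<open>w = R v\<close>.\<close>
  have adj: "(mat_adjoint R *\<^sub>v w) \<bullet>c v = w \<bullet>c (R *\<^sub>v v)" if "w \<in> carrier_vec n" for w
  proof -
    have "(mat_adjoint R *\<^sub>v w) \<bullet>c v = (\<Sum>i<m. \<Sum>j<n. cnj (R $$ (j, i)) * w $ j * cnj (v $ i))"
      using assms that by (auto simp: scalar_prod_def lessThan_atLeast0 sum_distrib_right)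
    also have "\<dots> = (\<Sum>j<n. \<Sum>i<m. cnj (R $$ (j, i)) * w $ j * cnj (v $ i))"
      by (rule sum.swap)
    also have "\<dots> = w \<bullet>c (R *\<^sub>v v)"
      using assms that
      by (auto simp: scalar_prod_def lessThan_atLeast0 sum_distrib_left mult_ac intro!: sum.cong)
    finally show ?thesis .
  qed
  then show ?thesis
    using assms by (simp add: assoc_mult_mat_vec[of _ m n _ m] mult_mat_vec_carrier[of _ n m])
qed

text \<open>A kernel vector \<open>v\<close> of \<open>F\<close> would give 0 = |Pv|^2 + |Qv|^2 +
  2|v|^2, which is impossible for \<open>v\<close> nonzero.\<close>

lemma det_nonzero_if_gram_positive:
  fixes F P Q :: "complex mat"
  assumes F: "F \<in> carrier_mat n n" and P: "P \<in> carrier_mat n n" and Q: "Q \<in> carrier_mat n n"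
    and gram: "mat_adjoint F * F = mat_adjoint P * P + mat_adjoint Q * Q + 2 \<cdot>\<^sub>m 1\<^sub>m n"
  shows "det F \<noteq> 0"
proof
  assume "det F = 0"
  then obtain v where v: "v \<in> carrier_vec n" "v \<noteq> 0\<^sub>v n" "F *\<^sub>v v = 0\<^sub>v n"
    using det_0_iff_vec_prod_zero[OF F] by auto
  have "0 = (mat_adjoint F * F *\<^sub>v v) \<bullet>c v"
    using cscalar_prod_mat_adjoint_mult[OF F v(1)] v by simp
  also have "\<dots> = (P *\<^sub>v v) \<bullet>c (P *\<^sub>v v) + (Q *\<^sub>v v) \<bullet>c (Q *\<^sub>v v) + 2 * (v \<bullet>c v)"
  proof -
    have PP: "mat_adjoint P * P \<in> carrier_mat n n" and QQ: "mat_adjoint Q * Q \<in> carrier_mat n n"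
      using P Q by (auto intro!: mult_carrier_mat[of _ n n])
    have two: "(2 \<cdot>\<^sub>m 1\<^sub>m n) *\<^sub>v v = (2::complex) \<cdot>\<^sub>v v"
      using v by (intro eq_vecI) auto
    have pq: "mat_adjoint P * P *\<^sub>v v \<in> carrier_vec n"
      "mat_adjoint Q * Q *\<^sub>v v \<in> carrier_vec n"
      using PP QQ v(1) by (auto intro: mult_mat_vec_carrier)
    have lin: "mat_adjoint F * F *\<^sub>v v =
        mat_adjoint P * P *\<^sub>v v + mat_adjoint Q * Q *\<^sub>v v + 2 \<cdot>\<^sub>v v"
      unfolding gram using PP QQ v(1) pq two by (simp add: add_mult_distrib_mat_vec[of _ n n] assoc_add_vec[of _ n])
    show ?thesis
      unfolding lin using P Q v(1) pq
      by (simp add: add_scalar_prod_distrib[of _ n] cscalar_prod_mat_adjoint_mult)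
  qed
  finally have sum0: "(P *\<^sub>v v) \<bullet>c (P *\<^sub>v v) + (Q *\<^sub>v v) \<bullet>c (Q *\<^sub>v v) + 2 * (v \<bullet>c v) = 0"
    by simp
  \<comment> \<open>These are inequalities in the partial order on complex numbers; taking real
    parts turns them into real ones that contradict \<open>sum0\<close>.\<close>
  have "(P *\<^sub>v v) \<bullet>c (P *\<^sub>v v) \<ge> 0" "(Q *\<^sub>v v) \<bullet>c (Q *\<^sub>v v) \<ge> 0"
    by (rule conjugate_square_ge_0_vec)+
  moreover have "v \<bullet>c v > 0"
    using conjugate_square_greater_0_vec[OF v(1)] v(2) by simp
  ultimately have "Re ((P *\<^sub>v v) \<bullet>c (P *\<^sub>v v)) \<ge> 0" "Re ((Q *\<^sub>v v) \<bullet>c (Q *\<^sub>v v)) \<ge> 0"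
    "Re (v \<bullet>c v) > 0"
    by (auto simp: less_eq_complex_def less_complex_def)
  with arg_cong[OF sum0, of Re] show False by simp
qed

section \<open>The matrix \<open>J\<close> and the inverse of a conjugate symplectic matrix\<close>

lemma symplectic_J_carrier [simp]: "symplectic_J N \<in> carrier_mat (2 * N) (2 * N)"
  unfolding symplectic_J_def
  using four_block_carrier_mat[of "0\<^sub>m N N" N N "0\<^sub>m N N" N N] by (simp add: mult_2)

lemma symplectic_J_square: "symplectic_J N * symplectic_J N = - 1\<^sub>m (2 * N)"
proof -
  have "symplectic_J N * symplectic_J N = four_block_mat (- 1\<^sub>m N) (0\<^sub>m N N) (0\<^sub>m N N) (- 1\<^sub>m N)"
    unfolding symplectic_J_def
    by (subst mult_four_block_mat[of _ N N _ N _ N _ _ N _ N]) (auto intro!: cong_four_block_mat)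
  also have "\<dots> = - 1\<^sub>m (2 * N)"
    by (rule eq_matI) auto
  finally show ?thesis .
qed

text \<open>Taking determinants in the defining relation gives det J = |det A|^2 det J, and det J
  cancels: it is nonzero because \<open>J\<close> squares to minus the identity.\<close>

lemma cmod_det_conjugate_symplectic:
  assumes "conjugate_symplectic N A"
  shows "cmod (det A) = 1"
proof -
  let ?J = "symplectic_J N"
  have A: "A \<in> carrier_mat (2 * N) (2 * N)" and eq: "mat_adjoint A * ?J * A = ?J"
    using assms by (auto simp: conjugate_symplectic_def)
  have "det ?J * det ?J = det (- 1\<^sub>m (2 * N) :: complex mat)"
    unfolding symplectic_J_square[symmetric]
    by (subst det_mult[OF symplectic_J_carrier symplectic_J_carrier]) simp
  also have "- 1\<^sub>m (2 * N) = (-1) \<cdot>\<^sub>m (1\<^sub>m (2 * N) :: complex mat)" by (rule eq_matI) auto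
  finally have J0: "det ?J \<noteq> 0" by auto
  have "det ?J = cnj (det A) * det ?J * det A"
    using A by (subst eq[symmetric])
      (simp add: det_mult[of _ "2 * N"] det_mat_adjoint[OF A] mult_carrier_mat[of _ "2 * N" "2 * N"])
  with J0 have "det A * cnj (det A) = 1" by (simp add: mult.commute)
  then have "(cmod (det A))\<^sup>2 = 1"
    by (metis complex_norm_square of_real_eq_1_iff)
  then show ?thesis by (simp add: power2_eq_1_iff) (smt (verit) norm_ge_zero)
qed

text \<open>Multiplying the defining relation by \<open>J\<close> on the left makes
  \<open>- (J * mat_adjoint A * J)\<close> a left inverse of \<open>A\<close>; written in blocks
  this is \<open>?B\<close>. A left inverse of a square matrix is also a right inverse.\<close>

lemma conjugate_symplectic_mult_inverse:
  assumes symp: "conjugate_symplectic N (four_block_mat A11 A12 A21 A22)"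
    and A11: "A11 \<in> carrier_mat N N" and A12: "A12 \<in> carrier_mat N N"
    and A21: "A21 \<in> carrier_mat N N" and A22: "A22 \<in> carrier_mat N N"
  shows "four_block_mat A11 A12 A21 A22 *
    four_block_mat (mat_adjoint A22) (- mat_adjoint A12) (- mat_adjoint A21) (mat_adjoint A11)
    = 1\<^sub>m (2 * N)" (is "?A * ?B = _")
proof -
  let ?J = "symplectic_J N"
  have A: "?A \<in> carrier_mat (2 * N) (2 * N)"
    using symp by (simp add: conjugate_symplectic_def)
  have cs: "mat_adjoint ?A * ?J \<in> carrier_mat (2 * N) (2 * N)"
    "?J * (mat_adjoint ?A * ?J) \<in> carrier_mat (2 * N) (2 * N)"
    using mat_adjoint_carrier[OF A] by (auto intro!: mult_carrier_mat[of _ "2 * N" "2 * N"])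
  have JAJ: "?J * (mat_adjoint ?A * ?J) = - ?B"
  proof -
    have neg1: "X * (- 1\<^sub>m N) = - X" "(- 1\<^sub>m N) * X = - X"
      if "X \<in> carrier_mat N N" for X :: "complex mat"
      using that by (metis uminus_mult_right_mat uminus_mult_left_mat right_mult_one_mat
          left_mult_one_mat one_carrier_mat carrier_matD index_one_mat(2,3))+
    have "mat_adjoint ?A * ?J =
      four_block_mat (- mat_adjoint A21) (mat_adjoint A11) (- mat_adjoint A22) (mat_adjoint A12)"
      unfolding symplectic_J_def mat_adjoint_four_block_mat[OF A11 A12 A21 A22]
      using A11 A12 A21 A22
      by (simp add: mult_four_block_mat[of _ N N _ N _ N _ _ N _ N] neg1)
    then have "?J * (mat_adjoint ?A * ?J) =
      four_block_mat (- mat_adjoint A22) (mat_adjoint A12) (mat_adjoint A21) (- mat_adjoint A11)"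
      unfolding symplectic_J_def using A11 A12 A21 A22
      by (auto simp: mult_four_block_mat[of _ N N _ N _ N _ _ N _ N] neg1
          intro!: cong_four_block_mat eq_matI)
    also have "\<dots> = - ?B"
      using A11 A12 A21 A22 by (intro eq_matI) auto
    finally show ?thesis .
  qed
  have B: "?B \<in> carrier_mat (2 * N) (2 * N)"
    using cs(2) unfolding JAJ by simp
  have "(- ?B) * ?A = ?J * (mat_adjoint ?A * ?J * ?A)"
    unfolding JAJ[symmetric] by (rule assoc_mult_mat[OF symplectic_J_carrier cs(1) A])
  also have "\<dots> = - 1\<^sub>m (2 * N)"
    using symp by (simp add: conjugate_symplectic_def symplectic_J_square)
  finally have "- (?B * ?A) = - 1\<^sub>m (2 * N)"
    using B A by (metis uminus_mult_left_mat carrier_matD)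
  then have "?B * ?A = 1\<^sub>m (2 * N)"
    by (metis uminus_uminus_mat)
  then show ?thesis by (rule mat_mult_left_right_inverse[OF B A])
qed

section \<open>The determinant relation between the two factors\<close>

lemma det_mult_cnj_det_conjugate_symplectic:
  assumes symp: "conjugate_symplectic N (four_block_mat A11 A12 A21 A22)"
    and A11: "A11 \<in> carrier_mat N N" and A12: "A12 \<in> carrier_mat N N"
    and A21: "A21 \<in> carrier_mat N N" and A22: "A22 \<in> carrier_mat N N"
  shows "det (four_block_mat A11 A12 A21 A22) *
      cnj (det ((A11 + A22) + \<i> \<cdot>\<^sub>m (A12 - A21))) =
    det ((A11 + A22) - \<i> \<cdot>\<^sub>m (A12 - A21))"
    (is "det ?A * cnj (det ?F) = det ?G")
proof -
  \<comment> \<open>\<open>W\<close> holds the block column (I, iI) on the left and \<open>V\<close>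
    holds (I, -iI) on the right. The zero halves let a factor act on one column only, so
    \<open>?B * W + V\<close> has block columns B(I, iI) and (I, -iI). \<open>T\<close> and
    \<open>S\<close> are the row operations of determinant 1 that will make
    \<open>?B * W + V\<close> and its image under \<open>?A\<close> triangular;
    \<open>(a, b)\<close> is the column B(I, iI).\<close>
  define I Z W V T S a b where defs: "I = (1\<^sub>m N :: complex mat)" "Z = (0\<^sub>m N N :: complex mat)"
    "W = four_block_mat I Z (\<i> \<cdot>\<^sub>m I) Z" "V = four_block_mat Z I Z (- \<i> \<cdot>\<^sub>m I)"
    "T = four_block_mat I (- \<i> \<cdot>\<^sub>m I) Z I" "S = four_block_mat I Z (- \<i> \<cdot>\<^sub>m I) I"
    "a = mat_adjoint A22 - \<i> \<cdot>\<^sub>m mat_adjoint A12"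
    "b = - mat_adjoint A21 + \<i> \<cdot>\<^sub>m mat_adjoint A11"
  let ?B = "four_block_mat (mat_adjoint A22) (- mat_adjoint A12) (- mat_adjoint A21) (mat_adjoint A11)"
  let ?n = "2 * N"
  have fc: "four_block_mat P Q R U \<in> carrier_mat ?n ?n"
    if "P \<in> carrier_mat N N" "U \<in> carrier_mat N N" for P Q R U :: "complex mat"
    using four_block_carrier_mat[OF that] by (simp add: mult_2)
  have I: "I \<in> carrier_mat N N" and Z: "Z \<in> carrier_mat N N"
    by (auto simp: defs)
  have ab: "a \<in> carrier_mat N N" "b \<in> carrier_mat N N"
    using A11 A12 A21 A22 by (auto simp: defs)
  have A: "?A \<in> carrier_mat ?n ?n" and B: "?B \<in> carrier_mat ?n ?n"
    and W: "W \<in> carrier_mat ?n ?n" and V: "V \<in> carrier_mat ?n ?n"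
    and T: "T \<in> carrier_mat ?n ?n" and S: "S \<in> carrier_mat ?n ?n"
    using A11 A12 A21 A22 I Z unfolding defs(3-6) by (auto intro!: fc)
  have mi: "X * (c \<cdot>\<^sub>m I) = c \<cdot>\<^sub>m X" "(c \<cdot>\<^sub>m I) * X = c \<cdot>\<^sub>m X" "X * I = X" "I * X = X"
    "X * Z = Z" "Z * X = Z" "X + Z = X" "Z + X = X" if "X \<in> carrier_mat N N" for c X
    using that unfolding defs(1,2) by (auto simp: mult_smult_distrib[of _ N N] mult_smult_assoc_mat[of _ N N])
  have X: "?B * W + V = four_block_mat a I b (- \<i> \<cdot>\<^sub>m I)"
  proof -
    have "?B * W = four_block_mat a Z b Z"
      unfolding defs(3,7,8) using A11 A12 A21 A22 I Z
      by (subst mult_four_block_mat[of _ N N _ N _ N _ _ N _ N])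
        (auto simp: mi intro!: cong_four_block_mat eq_matI)
    then show ?thesis
      unfolding defs(4) using ab I Z
      by (simp add: add_four_block_mat[of _ N N _ N _ N] mi)
  qed
  have Y: "W + ?A * V = four_block_mat I (A11 - \<i> \<cdot>\<^sub>m A12) (\<i> \<cdot>\<^sub>m I) (A21 - \<i> \<cdot>\<^sub>m A22)"
  proof -
    have AV: "?A * V = four_block_mat Z (A11 - \<i> \<cdot>\<^sub>m A12) Z (A21 - \<i> \<cdot>\<^sub>m A22)"
      unfolding defs(4) using A11 A12 A21 A22 I Z
      by (subst mult_four_block_mat[of _ N N _ N _ N _ _ N _ N])
        (auto simp: mi intro!: cong_four_block_mat eq_matI)
    show ?thesis
      unfolding AV unfolding defs(3) using A11 A12 A21 A22 I Z
      by (subst add_four_block_mat[of _ N N _ N _ N])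
        (auto simp: mi intro!: cong_four_block_mat)
  qed
  have AX: "?A * (?B * W + V) = W + ?A * V"
  proof -
    have "?A * (?B * W + V) = ?A * (?B * W) + ?A * V"
      by (rule mult_add_distrib_mat[OF A _ V]) (rule mult_carrier_mat[OF B W])
    also have "?A * (?B * W) = ?A * ?B * W"
      by (rule assoc_mult_mat[OF A B W, symmetric])
    also have "\<dots> = W"
      using W by (simp add: conjugate_symplectic_mult_inverse[OF assms])
    finally show ?thesis .
  qed
  have det_T: "det T = 1" and det_S: "det S = 1"
    unfolding defs(5,6) using I Z
    by (simp_all add: det_four_block_mat_lower_left_zero[of _ N _ N] defs(1,2)
        det_four_block_mat_upper_right_zero[of _ N _ N])
  \<comment> \<open>\<open>T\<close> subtracts i times the second block row from the first: the
    upper right block becomes I - i(-i)(-1)(-1)I - 2I + 2I = I + (-i)(-i)I = 0, and the upper left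
    one \<open>a - i b\<close> collects to the adjoint of \<open>?F\<close>.\<close>
  have "T * (?B * W + V) = four_block_mat (mat_adjoint ?F) Z b (- \<i> \<cdot>\<^sub>m I)"
    unfolding X unfolding defs(5) using A11 A12 A21 A22 I Z ab
    by (subst mult_four_block_mat[of _ N N _ N _ N _ _ N _ N])
      (auto simp: mi defs(1,2,7,8) algebra_simps intro!: cong_four_block_mat eq_matI)
  then have "det (T * (?B * W + V)) = cnj (det ?F) * det (- \<i> \<cdot>\<^sub>m I)"
    using A11 A12 A21 A22 I Z ab
    by (simp add: det_four_block_mat_upper_right_zero[of _ N _ N] defs(2) det_mat_adjoint[of _ N])
  moreover have "det (T * (?B * W + V)) = det (?B * W + V)"
    using V T by (simp add: det_mult[of _ ?n] det_T)
  ultimately have X': "det (?B * W + V) = cnj (det ?F) * det (- \<i> \<cdot>\<^sub>m I)" by simp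
  \<comment> \<open>\<open>S\<close> subtracts i times the first block row from the second: iI - iI
    = 0 on the left, and (A21 - i A22) - i(A11 - i A12) = -i G on the right.\<close>
  have "S * (W + ?A * V) = four_block_mat I (A11 - \<i> \<cdot>\<^sub>m A12) Z (- \<i> \<cdot>\<^sub>m ?G)"
    unfolding Y unfolding defs(6) using A11 A12 A21 A22 I Z
    by (subst mult_four_block_mat[of _ N N _ N _ N _ _ N _ N], simp_all add: mi)
      (auto simp: defs(1,2) algebra_simps intro!: cong_four_block_mat eq_matI)
  then have "det (S * (W + ?A * V)) = det (- \<i> \<cdot>\<^sub>m I) * det ?G"
    using A11 A12 A21 A22 I Z
    by (simp add: det_four_block_mat_lower_left_zero[of _ N _ N] defs(1,2) det_mult[of _ N])
  moreover have "det (S * (W + ?A * V)) = det (W + ?A * V)"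
    using A V S W by (simp add: det_mult[of _ ?n] det_S)
  ultimately have Y': "det (W + ?A * V) = det (- \<i> \<cdot>\<^sub>m I) * det ?G" by simp
  have "det ?A * det (?B * W + V) = det (W + ?A * V)"
    unfolding AX[symmetric] using A V by (simp add: det_mult[of _ ?n])
  \<comment> \<open>Both triangular forms contribute this same factor (-i)^N, so it cancels.\<close>
  moreover have "det (- \<i> \<cdot>\<^sub>m I) \<noteq> 0"
    by (simp add: defs(1))
  ultimately show ?thesis
    unfolding X' Y' by simp
qed

section \<open>Nonvanishing of the factors\<close>

text \<open>\<open>(P, Q)\<close> is the image under \<open>A\<close> of the block column (I, -iI).
  Since \<open>A\<close> preserves the form defined by \<open>J\<close>, that form takes the same
  value on both columns, and on (I, -iI) the value is -iI - iI.\<close>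

lemma gram_conjugate_symplectic:
  assumes symp: "conjugate_symplectic N (four_block_mat A11 A12 A21 A22)"
    and A11: "A11 \<in> carrier_mat N N" and A12: "A12 \<in> carrier_mat N N"
    and A21: "A21 \<in> carrier_mat N N" and A22: "A22 \<in> carrier_mat N N"
  defines "P \<equiv> A11 - \<i> \<cdot>\<^sub>m A12" and "Q \<equiv> A21 - \<i> \<cdot>\<^sub>m A22"
  shows "mat_adjoint P * Q - mat_adjoint Q * P = - (2 * \<i>) \<cdot>\<^sub>m 1\<^sub>m N"
proof -
  define V where V_def: "V = four_block_mat (0\<^sub>m N N) (1\<^sub>m N) (0\<^sub>m N N) (- \<i> \<cdot>\<^sub>m 1\<^sub>m N :: complex mat)"
  let ?A = "four_block_mat A11 A12 A21 A22" and ?J = "symplectic_J N" and ?n = "2 * N"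
  have V: "V \<in> carrier_mat ?n ?n"
    unfolding V_def using four_block_carrier_mat[of "0\<^sub>m N N" N N] by (simp add: mult_2)
  have A: "?A \<in> carrier_mat ?n ?n" and eq: "mat_adjoint ?A * ?J * ?A = ?J"
    using symp by (auto simp: conjugate_symplectic_def)
  have P: "P \<in> carrier_mat N N" and Q: "Q \<in> carrier_mat N N"
    using A11 A12 A21 A22 by (auto simp: P_def Q_def)
  have PQ: "mat_adjoint P * Q \<in> carrier_mat N N" "mat_adjoint Q * P \<in> carrier_mat N N"
    using P Q by (auto intro!: mult_carrier_mat[of _ N N])
  \<comment> \<open>The form of \<open>J\<close> on a block column \<open>(X, Y)\<close>. A zero
    left column pads it to a square matrix, so the value appears in the lower right block.\<close>
  have J_block: "mat_adjoint (four_block_mat (0\<^sub>m N N) X (0\<^sub>m N N) Y) * ?J * four_block_mat (0\<^sub>m N N) X (0\<^sub>m N N) Y =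
     four_block_mat (0\<^sub>m N N) (0\<^sub>m N N) (0\<^sub>m N N) (mat_adjoint X * Y - mat_adjoint Y * X)"
    if X: "X \<in> carrier_mat N N" and Y: "Y \<in> carrier_mat N N" for X Y
  proof -
    have z: "mat_adjoint (0\<^sub>m N N :: complex mat) = 0\<^sub>m N N"
      by (rule eq_matI) auto
    have m: "- mat_adjoint Y * X = - (mat_adjoint Y * X)" "mat_adjoint Y * (- 1\<^sub>m N) = - mat_adjoint Y"
      using X Y by (simp_all add: uminus_mult_left_mat uminus_mult_right_mat)
    have "mat_adjoint (four_block_mat (0\<^sub>m N N) X (0\<^sub>m N N) Y) * ?J =
      four_block_mat (0\<^sub>m N N) (0\<^sub>m N N) (- mat_adjoint Y) (mat_adjoint X)"
      unfolding symplectic_J_def using X Y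
      by (subst mat_adjoint_four_block_mat[of _ N N _ N _ N], (simp; fail)+)
        (subst mult_four_block_mat[of _ N N _ N _ N _ _ N _ N],
          auto simp: z m intro!: cong_four_block_mat)
    then show ?thesis
      using X Y
      by (simp add: mult_four_block_mat[of _ N N _ N _ N _ _ N _ N])
        (auto simp: m intro!: cong_four_block_mat eq_matI)
  qed
  have AV: "?A * V = four_block_mat (0\<^sub>m N N) P (0\<^sub>m N N) Q"
    unfolding V_def P_def Q_def using A11 A12 A21 A22
    by (subst mult_four_block_mat[of _ N N _ N _ N _ _ N _ N])
      (auto simp: mult_smult_distrib[of _ N N] intro!: cong_four_block_mat eq_matI)
  \<comment> \<open>\<open>J_block\<close> will apply to both ends of this chain: with
    \<open>(P, Q)\<close> on the left, and with X = I, Y = -iI on the right.\<close>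
  have "mat_adjoint (?A * V) * ?J * (?A * V) = mat_adjoint V * (mat_adjoint ?A * ?J * ?A) * V"
    using A V mat_adjoint_carrier[OF A] mat_adjoint_carrier[OF V]
    by (simp add: mat_adjoint_mult[OF A V] assoc_mult_mat[of _ ?n ?n _ ?n _ ?n]
        mult_carrier_mat[of _ ?n ?n])
  also have "\<dots> = mat_adjoint V * ?J * V" unfolding eq ..
  finally have "mat_adjoint P * Q - mat_adjoint Q * P =
      mat_adjoint (1\<^sub>m N) * (- \<i> \<cdot>\<^sub>m 1\<^sub>m N) - mat_adjoint (- \<i> \<cdot>\<^sub>m 1\<^sub>m N) * 1\<^sub>m N"
    using PQ unfolding AV unfolding V_def using J_block[OF P Q]
    by (subst (asm) (2) J_block) (auto elim!: four_block_mat_lower_right_eqD[of _ _ _ _ _ _ _ _ N N N N])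
  also have "\<dots> = - (2 * \<i>) \<cdot>\<^sub>m 1\<^sub>m N"
  proof -
    have "mat_adjoint (1\<^sub>m N :: complex mat) = 1\<^sub>m N" "mat_adjoint (- \<i> \<cdot>\<^sub>m 1\<^sub>m N) = \<i> \<cdot>\<^sub>m 1\<^sub>m N"
      by (auto intro!: eq_matI)
    then show ?thesis by (auto intro!: eq_matI)
  qed
  finally show ?thesis .
qed

text \<open>The factor equals \<open>P + i Q\<close>. Expanding its Gram matrix leaves the cross
  term i(P^H Q - Q^H P), with ^H the adjoint, which the preceding relation evaluates to i(-2i)I =
  2I; positivity then excludes a kernel.\<close>

lemma det_conjugate_symplectic_factor_nonzero:
  assumes symp: "conjugate_symplectic N (four_block_mat A11 A12 A21 A22)"
    and A11: "A11 \<in> carrier_mat N N" and A12: "A12 \<in> carrier_mat N N"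
    and A21: "A21 \<in> carrier_mat N N" and A22: "A22 \<in> carrier_mat N N"
  shows "det ((A11 + A22) - \<i> \<cdot>\<^sub>m (A12 - A21)) \<noteq> 0"
proof -
  define P Q where PQ_def: "P = A11 - \<i> \<cdot>\<^sub>m A12" "Q = A21 - \<i> \<cdot>\<^sub>m A22"
  have P: "P \<in> carrier_mat N N" and Q: "Q \<in> carrier_mat N N"
    using A11 A12 A21 A22 by (auto simp: PQ_def)
  have G: "(A11 + A22) - \<i> \<cdot>\<^sub>m (A12 - A21) = P + \<i> \<cdot>\<^sub>m Q" (is "?G = _")
    unfolding PQ_def using A11 A12 A21 A22 by (intro eq_matI) (auto simp: algebra_simps)
  have adj: "mat_adjoint (P + \<i> \<cdot>\<^sub>m Q) = mat_adjoint P - \<i> \<cdot>\<^sub>m mat_adjoint Q"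
    using P Q by (intro eq_matI) auto
  have c: "mat_adjoint P * P \<in> carrier_mat N N" "mat_adjoint P * Q \<in> carrier_mat N N"
     "mat_adjoint Q * P \<in> carrier_mat N N" "mat_adjoint Q * Q \<in> carrier_mat N N"
    using P Q by (auto intro!: mult_carrier_mat[of _ N N])
  have "mat_adjoint ?G * ?G = mat_adjoint P * P + mat_adjoint Q * Q
      + \<i> \<cdot>\<^sub>m (mat_adjoint P * Q - mat_adjoint Q * P)"
  proof -
    \<comment> \<open>Stated for arbitrary matrices so that the entrywise check treats the four
      products in \<open>c\<close> as opaque.\<close>
    have "X + \<i> \<cdot>\<^sub>m Y - \<i> \<cdot>\<^sub>m (Z + \<i> \<cdot>\<^sub>m W) = X + W + \<i> \<cdot>\<^sub>m (Y - Z)"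
      if "X \<in> carrier_mat N N" "Y \<in> carrier_mat N N" "Z \<in> carrier_mat N N" "W \<in> carrier_mat N N"
      for X Y Z W :: "complex mat"
      using that by (intro eq_matI) (auto simp: algebra_simps)
    note combine = this[OF c]
    have "mat_adjoint ?G * ?G = mat_adjoint P * (P + \<i> \<cdot>\<^sub>m Q) - \<i> \<cdot>\<^sub>m (mat_adjoint Q * (P + \<i> \<cdot>\<^sub>m Q))"
      unfolding G adj using P Q
      by (subst minus_mult_distrib_mat[of _ N N]) (auto simp: mult_smult_assoc_mat[of _ N N])
    also have "\<dots> = mat_adjoint P * P + \<i> \<cdot>\<^sub>m (mat_adjoint P * Q)
        - \<i> \<cdot>\<^sub>m (mat_adjoint Q * P + \<i> \<cdot>\<^sub>m (mat_adjoint Q * Q))"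
      using P Q by (simp add: mult_add_distrib_mat[of _ N N] mult_smult_distrib[of _ N N])
    finally show ?thesis unfolding combine .
  qed
  moreover have "\<i> \<cdot>\<^sub>m (mat_adjoint P * Q - mat_adjoint Q * P) = 2 \<cdot>\<^sub>m 1\<^sub>m N"
  proof -
    have "\<i> * - (2 * \<i>) = 2" by (simp add: complex_eq_iff)
    moreover have "\<i> \<cdot>\<^sub>m (c \<cdot>\<^sub>m 1\<^sub>m N) = (\<i> * c) \<cdot>\<^sub>m 1\<^sub>m N" for c
      by (rule eq_matI) auto
    ultimately show ?thesis
      unfolding PQ_def gram_conjugate_symplectic[OF assms] by (simp only:)
  qed
  ultimately have "mat_adjoint ?G * ?G = mat_adjoint P * P + mat_adjoint Q * Q + 2 \<cdot>\<^sub>m 1\<^sub>m N"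
    by (simp only:)
  then show ?thesis
    using P Q A11 A12 A21 A22 by (intro det_nonzero_if_gram_positive[of _ N P Q]) auto
qed

section \<open>Factorization and conclusion\<close>

text \<open>\<open>C\<close> and \<open>D\<close> need not commute: the cross terms -i CD + i DC of
  the product survive and are exactly the commutator term.\<close>

lemma square_add_square_minus_commutator:
  assumes C: "C \<in> carrier_mat N N" and D: "D \<in> carrier_mat N N"
  shows "C ^\<^sub>m 2 + D ^\<^sub>m 2 - \<i> \<cdot>\<^sub>m mat_commutator C D =
    (C + \<i> \<cdot>\<^sub>m D) * (C - \<i> \<cdot>\<^sub>m D)"
proof -
  have c: "C * C \<in> carrier_mat N N" "C * D \<in> carrier_mat N N"
     "D * C \<in> carrier_mat N N" "D * D \<in> carrier_mat N N"
    using C D by (auto intro!: mult_carrier_mat[of _ N N])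
  have p: "C ^\<^sub>m 2 = C * C" "D ^\<^sub>m 2 = D * D"
    using C D by (simp_all add: numeral_2_eq_2)
  have "X + W - \<i> \<cdot>\<^sub>m (Y - Z) = X - \<i> \<cdot>\<^sub>m Y + \<i> \<cdot>\<^sub>m (Z - \<i> \<cdot>\<^sub>m W)"
    if "X \<in> carrier_mat N N" "Y \<in> carrier_mat N N" "Z \<in> carrier_mat N N" "W \<in> carrier_mat N N"
    for X Y Z W :: "complex mat"
    using that by (intro eq_matI) (auto simp: algebra_simps)
  note combine = this[OF c]
  have "(C + \<i> \<cdot>\<^sub>m D) * (C - \<i> \<cdot>\<^sub>m D) = C * (C - \<i> \<cdot>\<^sub>m D) + \<i> \<cdot>\<^sub>m (D * (C - \<i> \<cdot>\<^sub>m D))"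
    using C D by (subst add_mult_distrib_mat[of _ N N]) (auto simp: mult_smult_assoc_mat[of _ N N])
  also have "\<dots> = C * C - \<i> \<cdot>\<^sub>m (C * D) + \<i> \<cdot>\<^sub>m (D * C - \<i> \<cdot>\<^sub>m (D * D))"
    using C D by (simp add: mult_minus_distrib_mat[of _ N N] mult_smult_distrib[of _ N N])
  finally show ?thesis
    unfolding p mat_commutator_def combine by simp
qed

theorem mainTheorem3:
  fixes N :: nat and A A11 A12 A21 A22 :: "complex mat"
  assumes "N \<ge> 1"
    and "conjugate_symplectic N A"
    and "A11 \<in> carrier_mat N N" and "A12 \<in> carrier_mat N N"
    and "A21 \<in> carrier_mat N N" and "A22 \<in> carrier_mat N N"
    and "A = four_block_mat A11 A12 A21 A22"
  shows "det A =
    det ((A11 + A22) ^\<^sub>m 2 + (A12 - A21) ^\<^sub>m 2 - \<i> \<cdot>\<^sub>m mat_commutator (A11 + A22) (A12 - A21)) /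
    complex_of_real (cmod (det ((A11 + A22) ^\<^sub>m 2 + (A12 - A21) ^\<^sub>m 2 - \<i> \<cdot>\<^sub>m mat_commutator (A11 + A22) (A12 - A21))))"
proof -
  let ?C = "A11 + A22" and ?D = "A12 - A21"
  define f g where fg: "f = det (?C + \<i> \<cdot>\<^sub>m ?D)" "g = det (?C - \<i> \<cdot>\<^sub>m ?D)"
  have C: "?C \<in> carrier_mat N N" and D: "?D \<in> carrier_mat N N"
    using assms by auto
  have M: "det (?C ^\<^sub>m 2 + ?D ^\<^sub>m 2 - \<i> \<cdot>\<^sub>m mat_commutator ?C ?D) = f * g"
    unfolding square_add_square_minus_commutator[OF C D] fg
    by (rule det_mult[of _ N]) (use C D in auto)
  have symp: "conjugate_symplectic N (four_block_mat A11 A12 A21 A22)"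
    using assms by simp
  have g: "g = det A * cnj f"
    unfolding fg assms(7)
    by (rule det_mult_cnj_det_conjugate_symplectic[OF symp assms(3-6), symmetric])
  \<comment> \<open>Nonvanishing is known for \<open>g\<close>; the relation
    \<open>g = det A * cnj f\<close> carries it over to \<open>f\<close>, so the denominator is
    nonzero.\<close>
  have "g \<noteq> 0"
    unfolding fg by (rule det_conjugate_symplectic_factor_nonzero[OF symp assms(3-6)])
  then have "f \<noteq> 0" using g by auto
  \<comment> \<open>Substituting for \<open>g\<close> produces \<open>f * cnj f\<close>, the squared
    modulus of \<open>f\<close>. As \<open>det A\<close> has modulus 1, this square is also the
    modulus of \<open>f * g\<close>, and the quotient is \<open>det A\<close>.\<close>
  have "f * g = det A * (complex_of_real (cmod f))\<^sup>2"
    unfolding g using complex_norm_square[of f] by (simp add: mult_ac)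
  moreover have "cmod (f * g) = (cmod f)\<^sup>2"
    unfolding g using cmod_det_conjugate_symplectic[OF assms(2)]
    by (simp add: norm_mult power2_eq_square)
  ultimately show ?thesis
    unfolding M using \<open>f \<noteq> 0\<close> by simp
qed

end
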